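(* Let $n\ge1$ and let $H\in\mathbb{R}^{n\times n}$ be symmetric positive definite. There exist constants $C_H\ge 1$ and $\rho_H\in(0,1)$, depending only on $H$, such that for every positive spectral weight $W=\omega(H)$, $$\lVert T_W^k(u,v)\rVert_\times\le C_H\sqrt{\kappa_2(W)}\,\rho_H^k\,\lVert(u,v)\rVert_\times\qquad\text{for all }(u,v)\in\Omega_{\rm BB}(H),\ k\ge 0.$$ This includes the cases $W=I$ (BB1), $W=H$ (BB2), and every fixed power weight $W=H^\tau$ with $\tau\in\mathbb{R}$.
   Context: Let $a:=\lambda_{\min}(H)>0$ and $b:=\lambda_{\max}(H)$ be the smallest and largest eigenvalues of $H$. A positive spectral weight is a matrix $W=\omega(H)$ (functional calculus), where $\omega$ is a real function on the spectrum $\sigma(H)$ with $\omega(\lambda)>0$ for every $\lambda\in\sigma(H)$; thus $W$ is symmetric positive definite and $WH=HW$. Write $\kappa_2(W):=\lVert W\rVert_2\lVert W^{-1}\rVert_2$ (spectral norm). For $u\in\mathbb{R}^n\setminus\{0\}$ set $\alpha_W(u):=\dfrac{u^TWu}{u^TWHu}$, which lies in $[b^{-1},a^{-1}]$. The compatible cone is $$\Omega_{\rm BB}(H):=\{(u,v)\in\mathbb{R}^n\times\mathbb{R}^n: v=(I-\alpha H)u\text{ for some }\alpha\in[b^{-1},a^{-1}]\}.$$ Its only element with $u=0$ is $(0,0)$. Define $T_W:\Omega_{\rm BB}(H)\to\Omega_{\rm BB}(H)$ by $T_W(u,v):=\bigl(v,(I-\alpha_W(u)H)v\bigr)$ if $u\ne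 0$, and $T_W(0,0):=(0,0)$. $T_W^k$ is the $k$-fold composition. The product norm is $\lVert(u,v)\rVert_\times:=(\lVert u\rVert^2+\lVert v\rVert^2)^{1/2}$ with $\lVert\cdot\rVert$ the Euclidean norm. *)

theory Defs
  imports "HOL-Analysis.Analysis"
begin

definition sym_pos_def :: "real^'n^'n \<Rightarrow> bool" where
  "sym_pos_def A \<longleftrightarrow> transpose A = A \<and> (\<forall>x. x \<noteq> 0 \<longrightarrow> x \<bullet> (A *v x) > 0)"

text \<open>Only real eigenvalues are collected; a symmetric matrix has no others.\<close>

definition spectrum :: "real^'n^'n \<Rightarrow> real set" where
  "spectrum A = {l. \<exists>x. x \<noteq> 0 \<and> A *v x = l *\<^sub>R x}"

definition lambda_min :: "real^'n^'n \<Rightarrow> real" where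
  "lambda_min A = Min (spectrum A)"

definition lambda_max :: "real^'n^'n \<Rightarrow> real" where
  "lambda_max A = Max (spectrum A)"

definition eigenspace :: "real^'n^'n \<Rightarrow> real \<Rightarrow> (real^'n) set" where
  "eigenspace A l = {x. A *v x = l *\<^sub>R x}"

text \<open>The nearest-point map of a linear subspace is the orthogonal projection onto it, so this is
  the matrix of the orthogonal projection onto the eigenspace.\<close>

definition eigenprojection :: "real^'n^'n \<Rightarrow> real \<Rightarrow> real^'n^'n" where
  "eigenprojection A l = matrix (closest_point (eigenspace A l))"

text \<open>Functional calculus of a symmetric matrix through its spectral resolution. Values of
  \<open>\<omega>\<close> outside the spectrum are irrelevant.\<close>

definition matrix_fun :: "(real \<Rightarrow> real) \<Rightarrow> real^'n^'n \<Rightarrow> real^'n^'n" where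
  "matrix_fun \<omega> A = (\<Sum>l\<in>spectrum A. \<omega> l *\<^sub>R eigenprojection A l)"

definition matrix_powr :: "real^'n^'n \<Rightarrow> real \<Rightarrow> real^'n^'n" where
  "matrix_powr A \<tau> = matrix_fun (\<lambda>l. l powr \<tau>) A"

definition positive_spectral_weight :: "real^'n^'n \<Rightarrow> real^'n^'n \<Rightarrow> bool" where
  "positive_spectral_weight H W \<longleftrightarrow>
     (\<exists>\<omega>. (\<forall>l\<in>spectrum H. \<omega> l > 0) \<and> W = matrix_fun \<omega> H)"

definition spectral_norm :: "real^'n^'n \<Rightarrow> real" where
  "spectral_norm A = onorm ((*v) A)"

definition cond2 :: "real^'n^'n \<Rightarrow> real" where
  "cond2 W = spectral_norm W * spectral_norm (matrix_inv W)"

definition alpha_W :: "real^'n^'n \<Rightarrow> real^'n^'n \<Rightarrow> real^'n \<Rightarrow> real" where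
  "alpha_W H W u = (u \<bullet> (W *v u)) / (u \<bullet> ((W ** H) *v u))"

definition Omega_BB :: "real^'n^'n \<Rightarrow> ((real^'n) \<times> (real^'n)) set" where
  "Omega_BB H = {(u, v). \<exists>\<alpha>\<in>{1 / lambda_max H .. 1 / lambda_min H}.
     v = (mat 1 - \<alpha> *\<^sub>R H) *v u}"

text \<open>A total function, meant to be applied on \<open>Omega_BB H\<close>, where \<open>u = 0\<close> forces \<open>v = 0\<close>.\<close>

definition T_W :: "real^'n^'n \<Rightarrow> real^'n^'n \<Rightarrow> (real^'n) \<times> (real^'n) \<Rightarrow> (real^'n) \<times> (real^'n)" where
  "T_W H W = (\<lambda>(u, v). if u = 0 then (0, 0)
     else (v, (mat 1 - alpha_W H W u *\<^sub>R H) *v v))"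

end

theory Submission
  imports Defs
begin

text \<open>
  Let \<open>a\<close> and \<open>b\<close> be the extreme eigenvalues of \<open>H\<close>. Along an orbit of \<open>T_W\<close> the vectors satisfy
  \<open>g\<^sub>k\<^sub>+\<^sub>1 = (I - \<alpha>\<^sub>k H) g\<^sub>k\<close>, where \<open>\<alpha>\<^sub>k\<^sub>+\<^sub>1 = \<alpha>_W(g\<^sub>k)\<close>. Write \<open>P\<^sub>l\<close> for the orthogonal projection
  onto the eigenspace of \<open>l\<close> and, for \<open>W = \<omega>(H)\<close>, put \<open>y\<^sub>l(k) = sqrt (\<omega> l) * norm (P\<^sub>l g\<^sub>k)\<close>. In
  these variables the weight disappears: each mode is multiplied by \<open>\<bar>1 - \<alpha>\<^sub>k l\<bar>\<close>, and
  \<open>1 / \<alpha>\<^sub>k\<^sub>+\<^sub>1\<close> is the mean of the eigenvalues with weights \<open>y\<^sub>l(k)\<^sup>2\<close>. In other words, multiplying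
  by the square root of \<open>W\<close> turns \<open>T_W\<close> into \<open>T_I\<close>. It is therefore enough to bound the modes by
  constants that depend only on \<open>a\<close>, \<open>b\<close> and the spectrum; the passage between \<open>g\<close> and \<open>y\<close>
  costs at most the factor \<open>sqrt (\<omega> m / \<omega> l)\<close>, which is at most \<open>sqrt (cond2 W)\<close>
  (lemma \<open>cond2_matrix_fun_ge\<close>).

  The modes are bounded one after the other, in increasing order of the eigenvalue \<open>l\<close>, all with
  the same rate \<open>r = max (1/2) (1 - a/b)\<close>. There are two cases at each time \<open>k\<close>.
  If \<open>y\<^sub>l(k)\<^sup>2\<close> is at least twice the sum of the squares of the lower modes, then at least two
  thirds of the total weight sits on eigenvalues \<open>\<ge> l\<close>, so \<open>\<alpha>\<^sub>k\<^sub>+\<^sub>1 l \<le> 3/2\<close>. As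
  \<open>\<alpha>\<^sub>k\<^sub>+\<^sub>1 l \<ge> a/b\<close> always holds, the step from \<open>k + 1\<close> to \<open>k + 2\<close> contracts the mode by \<open>r\<close>
  (lemma \<open>bb_modes_contraction\<close>). Otherwise \<open>y\<^sub>l(k)\<close> is dominated by the lower modes, which
  already decay like \<open>r ^ k\<close>, and two steps enlarge it by at most \<open>(b/a)\<^sup>2\<close>; this loss is absorbed
  by the constant. Induction on \<open>k\<close> gives the bound for the mode \<open>l\<close> (lemma
  \<open>bb_mode_decay_step\<close>), and induction over the finite spectrum gives it for all modes (lemma
  \<open>bb_modes_decay\<close>).

  The remaining ingredient is the spectral theorem in the form \<open>\<Sum>l. P\<^sub>l = I\<close>
  (lemma \<open>sum_eigenprojections\<close>): a Rayleigh quotient attains its maximum on the unit sphere of any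
  nonzero invariant subspace, so the orthogonal complement of all eigenspaces must be trivial.
\<close>

section \<open>Scalar dynamics of the spectral modes\<close>

text \<open>The last condition says that \<open>1 / \<alpha> (Suc k)\<close> is a weighted mean of \<open>S\<close>. It is stated
  without division so that it imposes nothing once all modes vanish; the step size is then an
  arbitrary element of the interval. The index shift is the one-step delay of the Barzilai-Borwein
  rule, and \<open>\<alpha> 0\<close> is the initial step that couples the two vectors of a starting pair.\<close>

definition bb_modes :: "real \<Rightarrow> real \<Rightarrow> real set \<Rightarrow> (nat \<Rightarrow> real) \<Rightarrow> (real \<Rightarrow> nat \<Rightarrow> real) \<Rightarrow> bool" where
  "bb_modes a b S \<alpha> y \<longleftrightarrow>
     (\<forall>k. \<alpha> k \<in> {1 / b .. 1 / a}) \<and>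
     (\<forall>l\<in>S. \<forall>k. 0 \<le> y l k) \<and>
     (\<forall>l\<in>S. \<forall>k. y l (Suc k) = \<bar>1 - \<alpha> k * l\<bar> * y l k) \<and>
     (\<forall>k. \<alpha> (Suc k) * (\<Sum>l\<in>S. l * (y l k)\<^sup>2) = (\<Sum>l\<in>S. (y l k)\<^sup>2))"

definition bb_rate :: "real \<Rightarrow> real \<Rightarrow> real" where
  "bb_rate a b = max (1 / 2) (1 - a / b)"

lemma bb_rate_bounds:
  assumes "0 < a" "a \<le> b"
  shows "0 < bb_rate a b" "bb_rate a b < 1"
  using assms by (auto simp: bb_rate_def max_def divide_simps)

lemma step_size_times_mode_bounds:
  fixes a b l s :: real
  assumes "0 < a" "l \<in> {a..b}" "s \<in> {1 / b .. 1 / a}"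
  shows "a / b \<le> s * l" "s * l \<le> b / a"
proof -
  have "0 < b" "0 < l" using assms by auto
  have "(1 / b) * a \<le> s * l"
    using assms \<open>0 < b\<close> by (intro mult_mono) (auto intro: order_trans[of 0 "1 / b"])
  then show "a / b \<le> s * l" by simp
  have "s * l \<le> (1 / a) * b"
    using assms \<open>0 < l\<close> by (intro mult_mono) auto
  then show "s * l \<le> b / a" by simp
qed

lemma bb_modes_growth:
  assumes m: "bb_modes a b S \<alpha> y" and "0 < a" "S \<subseteq> {a..b}" "l \<in> S"
  shows "y l (Suc k) \<le> b / a * y l k"
proof -
  have "a \<le> l" "l \<le> b" using assms by auto
  have "a / b \<le> \<alpha> k * l" "\<alpha> k * l \<le> b / a"
    using step_size_times_mode_bounds[of a l b "\<alpha> k"] assms by (auto simp: bb_modes_def)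
  moreover have "0 < a / b" "1 \<le> b / a" using \<open>0 < a\<close> \<open>a \<le> l\<close> \<open>l \<le> b\<close> by auto
  ultimately have "\<bar>1 - \<alpha> k * l\<bar> \<le> b / a" by linarith
  moreover have "0 \<le> y l k" "y l (Suc k) = \<bar>1 - \<alpha> k * l\<bar> * y l k"
    using m \<open>l \<in> S\<close> by (auto simp: bb_modes_def)
  ultimately show ?thesis by (metis mult_right_mono)
qed

text \<open>The set \<open>A\<close> plays the role of the eigenvalues below \<open>l\<close>. If \<open>G\<close> is their weight and
  \<open>s\<close> the remaining weight, then \<open>2 * G \<le> s\<close>, while the weighted sum of the eigenvalues is at least
  \<open>l * s\<close>; hence the step size is at most \<open>(s + G) / (l * s)\<close>, which is at most
  \<open>3 / (2 * l)\<close>.\<close>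

lemma bb_modes_contraction:
  assumes m: "bb_modes a b S \<alpha> y" and a: "0 < a" "S \<subseteq> {a..b}" and l: "l \<in> S"
    and fin: "finite S" and A: "A \<subseteq> S" "\<And>m. m \<in> S - A \<Longrightarrow> l \<le> m" "l \<notin> A"
    and dom: "2 * (\<Sum>m\<in>A. (y m k)\<^sup>2) \<le> (y l k)\<^sup>2"
  shows "y l (Suc (Suc k)) \<le> bb_rate a b * y l (Suc k)"
proof (cases "y l k = 0")
  case True
  then have "y l (Suc k) = 0" "y l (Suc (Suc k)) = 0" using m l by (auto simp: bb_modes_def)
  then show ?thesis by simp
next
  case False
  define s G where "s = (\<Sum>m\<in>S - A. (y m k)\<^sup>2)" and "G = (\<Sum>m\<in>A. (y m k)\<^sup>2)"
  have al: "\<alpha> (Suc k) \<in> {1 / b .. 1 / a}" using m by (auto simp: bb_modes_def)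
  have pos: "0 < l" "0 < b" using a l by auto
  have al0: "0 \<le> \<alpha> (Suc k)" using al pos by (auto intro: order_trans[of 0 "1 / b"])
  have "(y l k)\<^sup>2 \<le> s"
    unfolding s_def by (rule member_le_sum) (use l A fin in auto)
  moreover have "0 < (y l k)\<^sup>2" using False by simp
  ultimately have s: "0 < s" "2 * G \<le> s" using dom unfolding G_def by linarith+
  have "l * s \<le> (\<Sum>m\<in>S - A. m * (y m k)\<^sup>2)"
    unfolding s_def sum_distrib_left by (rule sum_mono) (use A in \<open>auto intro!: mult_right_mono\<close>)
  also have "\<dots> \<le> (\<Sum>m\<in>S. m * (y m k)\<^sup>2)"
    by (rule sum_mono2) (use fin a in \<open>auto intro!: mult_nonneg_nonneg\<close>)
  finally have "\<alpha> (Suc k) * (l * s) \<le> \<alpha> (Suc k) * (\<Sum>m\<in>S. m * (y m k)\<^sup>2)"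
    using al0 by (rule mult_left_mono)
  also have "\<dots> = (\<Sum>m\<in>S. (y m k)\<^sup>2)" using m by (auto simp: bb_modes_def)
  also have "\<dots> = s + G" unfolding s_def G_def by (rule sum.subset_diff[OF A(1) fin])
  also have "\<dots> \<le> 3 / 2 * s" using s by simp
  finally have "\<alpha> (Suc k) * l * s \<le> 3 / 2 * s" by (simp add: mult.assoc)
  then have "\<alpha> (Suc k) * l \<le> 3 / 2" using s(1) by simp
  moreover have "a / b \<le> \<alpha> (Suc k) * l"
    using step_size_times_mode_bounds[of a l b "\<alpha> (Suc k)"] a l al by auto
  ultimately have "\<bar>1 - \<alpha> (Suc k) * l\<bar> \<le> bb_rate a b" by (auto simp: bb_rate_def)
  then show ?thesis using m l by (auto simp: bb_modes_def intro!: mult_right_mono)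
qed

text \<open>The lower bounds on \<open>D\<close> are exactly what the induction on \<open>k\<close> asks for: the first at
  \<open>k = 0\<close>, the second at \<open>k = 1\<close>, where no earlier weight controls the step size, and the third
  whenever the lower modes dominate. A contracting step preserves the bound for every \<open>D\<close>,
  because the bound shrinks by exactly the contraction factor.\<close>

lemma bb_mode_decay_step:
  assumes m: "bb_modes a b S \<alpha> y" and a: "0 < a" "S \<subseteq> {a..b}" and l: "l \<in> S"
    and fin: "finite S" and A: "A \<subseteq> S" "\<And>m. m \<in> S - A \<Longrightarrow> l \<le> m" "l \<notin> A"
    and N: "y l 0 \<le> N" and C: "0 \<le> C"
    and low: "\<And>m k. m \<in> A \<Longrightarrow> y m k \<le> C * bb_rate a b ^ k * N"
    and D: "1 \<le> D" "b / a \<le> D * bb_rate a b"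
      "(b / a)\<^sup>2 * (2 * real (card A) * C) \<le> D * (bb_rate a b)\<^sup>2"
  shows "y l k \<le> D * bb_rate a b ^ k * N"
proof -
  define r where "r = bb_rate a b"
  have ab: "a \<le> b" using a l by auto
  have r: "0 < r" using bb_rate_bounds a ab by (auto simp: r_def)
  have M: "0 \<le> b / a" using a ab by auto
  have y0: "\<And>m k. m \<in> S \<Longrightarrow> 0 \<le> y m k" using m by (auto simp: bb_modes_def)
  have N0: "0 \<le> N" using y0[OF l, of 0] N by linarith
  have grow: "y l (Suc k) \<le> b / a * y l k" for k
    using bb_modes_growth[OF m a l] .
  have two: "y l (Suc (Suc k)) \<le> D * r ^ Suc (Suc k) * N"
    if IH: "y l (Suc k) \<le> D * r ^ Suc k * N" for k
  proof (cases "2 * (\<Sum>m\<in>A. (y m k)\<^sup>2) \<le> (y l k)\<^sup>2")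
    case True
    have "y l (Suc (Suc k)) \<le> r * y l (Suc k)"
      using bb_modes_contraction[OF m a l fin A True] by (simp add: r_def)
    also have "\<dots> \<le> r * (D * r ^ Suc k * N)" using IH r by (intro mult_left_mono) auto
    finally show ?thesis by (simp add: ac_simps)
  next
    case False
    define B where "B = C * r ^ k * N"
    have B0: "0 \<le> B" using C r N0 by (simp add: B_def)
    have "(\<Sum>m\<in>A. (y m k)\<^sup>2) \<le> (\<Sum>m\<in>A. B\<^sup>2)"
      using low A y0 by (intro sum_mono power_mono) (auto simp: B_def r_def)
    also have "\<dots> = card A * B\<^sup>2" by simp
    finally have "(y l k)\<^sup>2 < 2 * (card A * B\<^sup>2)" using False by linarith
    \<comment> \<open>An integer is at most its square, which avoids a square root of the cardinality.\<close>
    also have "\<dots> \<le> (2 * real (card A) * B)\<^sup>2"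
    proof -
      have "2 * real (card A) \<le> (2 * real (card A)) ^ 2"
        by (cases "card A") (auto simp: power2_eq_square)
      then have "(2 * real (card A)) * B\<^sup>2 \<le> (2 * real (card A)) ^ 2 * B\<^sup>2"
        by (intro mult_right_mono) auto
      then show ?thesis by (simp add: power_mult_distrib)
    qed
    finally have "y l k \<le> 2 * real (card A) * B"
      using B0 by (intro power2_le_imp_le[of "y l k"]) auto
    then have "(b / a)\<^sup>2 * y l k \<le> (b / a)\<^sup>2 * (2 * real (card A) * B)"
      by (rule mult_left_mono) simp
    moreover have "y l (Suc (Suc k)) \<le> (b / a)\<^sup>2 * y l k"
      using order_trans[OF grow mult_left_mono[OF grow M]]
      by (simp add: power2_eq_square mult.assoc)
    ultimately have "y l (Suc (Suc k)) \<le> (b / a)\<^sup>2 * (2 * real (card A) * B)" by linarith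
    also have "\<dots> = (b / a)\<^sup>2 * (2 * real (card A) * C) * (r ^ k * N)" by (simp add: B_def ac_simps)
    also have "\<dots> \<le> D * r\<^sup>2 * (r ^ k * N)"
      using D(3) r N0 by (intro mult_right_mono) (auto simp: r_def)
    finally show ?thesis by (simp add: power2_eq_square ac_simps)
  qed
  have one: "y l (Suc 0) \<le> D * r ^ Suc 0 * N"
  proof -
    have "y l (Suc 0) \<le> b / a * N" using order_trans[OF grow mult_left_mono[OF N M]] .
    also have "\<dots> \<le> D * r * N" using D(2) N0 by (intro mult_right_mono) (auto simp: r_def)
    finally show ?thesis by simp
  qed
  have Suc: "y l (Suc k) \<le> D * r ^ Suc k * N" for k
    by (induction k) (use one two in auto)
  have zero: "y l 0 \<le> D * r ^ 0 * N"
    using order_trans[OF N] mult_right_mono[OF D(1) N0] by simp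
  show ?thesis using Suc zero by (cases k) (auto simp: r_def)
qed

text \<open>The induction runs over the subsets \<open>A\<close> of \<open>S\<close> that contain with an eigenvalue all smaller
  ones, adding one eigenvalue at a time from the bottom. The dynamics always involves all of \<open>S\<close>;
  only the set of modes already bounded grows. The smallest eigenvalue is an
  instance of the same step: with no lower modes the contracting case always applies.\<close>

lemma bb_modes_decay:
  assumes fin: "finite S" and a: "0 < a" "a \<le> b" "S \<subseteq> {a..b}"
  shows "\<exists>C\<ge>1. \<forall>\<alpha> y N. bb_modes a b S \<alpha> y \<longrightarrow> (\<forall>l\<in>S. y l 0 \<le> N) \<longrightarrow>
           (\<forall>l\<in>S. \<forall>k. y l k \<le> C * bb_rate a b ^ k * N)"
proof -
  define r where "r = bb_rate a b"
  have r: "0 < r" "r < 1" using bb_rate_bounds a by (auto simp: r_def)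
  have "A \<subseteq> S \<longrightarrow> (\<forall>s\<in>S. \<forall>t\<in>A. s \<le> t \<longrightarrow> s \<in> A) \<longrightarrow>
      (\<exists>C\<ge>1. \<forall>\<alpha> y N. bb_modes a b S \<alpha> y \<longrightarrow> (\<forall>l\<in>S. y l 0 \<le> N) \<longrightarrow>
           (\<forall>l\<in>A. \<forall>k. y l k \<le> C * r ^ k * N))" if "finite A" for A
    using that
  proof (induction A rule: finite_linorder_max_induct)
    case empty
    then show ?case by (auto intro: exI[of _ 1])
  next
    case (insert l A)
    show ?case
    proof (intro impI)
      assume sub: "insert l A \<subseteq> S" and low: "\<forall>s\<in>S. \<forall>t\<in>insert l A. s \<le> t \<longrightarrow> s \<in> insert l A"
      have "\<forall>s\<in>S. \<forall>t\<in>A. s \<le> t \<longrightarrow> s \<in> A" using low insert.hyps by fastforce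
      then obtain C where C: "1 \<le> C"
        "\<And>\<alpha> y N m k. bb_modes a b S \<alpha> y \<Longrightarrow> (\<forall>l\<in>S. y l 0 \<le> N) \<Longrightarrow> m \<in> A \<Longrightarrow> y m k \<le> C * r ^ k * N"
        using insert.IH sub by auto
      define D where "D = C + b / a / r + (b / a)\<^sup>2 * (2 * real (card A) * C) / r\<^sup>2"
      have nn: "0 \<le> b / a / r" "0 \<le> (b / a)\<^sup>2 * (2 * real (card A) * C) / r\<^sup>2"
        using a r C by auto
      have "C \<le> D" unfolding D_def using nn by linarith
      have "1 \<le> D" using \<open>C \<le> D\<close> C by linarith
      have "b / a / r \<le> D" unfolding D_def using nn C by linarith
      then have D2: "b / a \<le> D * r" using r by (simp only: pos_divide_le_eq)
      have "(b / a)\<^sup>2 * (2 * real (card A) * C) / r\<^sup>2 \<le> D" unfolding D_def using nn C by linarith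
      then have D3: "(b / a)\<^sup>2 * (2 * real (card A) * C) \<le> D * r\<^sup>2"
        using r by (simp only: pos_divide_le_eq zero_less_power)
      have "y m k \<le> D * r ^ k * N"
        if m: "bb_modes a b S \<alpha> y" and N: "\<forall>l\<in>S. y l 0 \<le> N" and mA: "m \<in> insert l A" for \<alpha> y N m k
      proof (cases "m = l")
        case True
        have rest: "l \<le> m" if "m \<in> S - A" for m
          using that low by (metis DiffD1 DiffD2 insertCI insertE linear order.refl)
        show ?thesis unfolding True r_def
          by (rule bb_mode_decay_step[OF m a(1,3) _ fin, where A = A and C = C])
             (use sub insert.hyps rest N C m \<open>1 \<le> D\<close> D2 D3 in \<open>auto simp: r_def\<close>)
      next
        case False
        then have "m \<in> S" using mA sub by auto
        then have "0 \<le> y m 0" using m by (auto simp: bb_modes_def)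
        then have "0 \<le> N" using N \<open>m \<in> S\<close> by force
        have "y m k \<le> C * r ^ k * N" using C(2)[OF m N] False mA by auto
        also have "\<dots> \<le> D * r ^ k * N"
          using \<open>C \<le> D\<close> r \<open>0 \<le> N\<close> by (intro mult_right_mono) auto
        finally show ?thesis .
      qed
      then show "\<exists>C\<ge>1. \<forall>\<alpha> y N. bb_modes a b S \<alpha> y \<longrightarrow> (\<forall>l\<in>S. y l 0 \<le> N) \<longrightarrow>
           (\<forall>l\<in>insert l A. \<forall>k. y l k \<le> C * r ^ k * N)"
        using \<open>1 \<le> D\<close> by (intro exI[of _ D]) auto
    qed
  qed
  from this[OF fin] show ?thesis by (auto simp: r_def)
qed

section \<open>Spectral resolution of a symmetric matrix\<close>

lemma symmetric_matrix_self_adjoint: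
  fixes A :: "real^'n^'n"
  assumes "transpose A = A"
  shows "x \<bullet> (A *v y) = (A *v x) \<bullet> y"
  by (metis assms dot_lmul_matrix transpose_matrix_vector)

text \<open>A maximizer \<open>x\<close> of the Rayleigh quotient on the unit sphere of \<open>V\<close> is an eigenvector.
  Its residual \<open>y = A x - \<mu> x\<close> lies in \<open>V\<close> because \<open>V\<close> is invariant, so \<open>x + t y\<close> is a
  competitor. Its first order gain is \<open>2 * t * (y \<bullet> y)\<close>, which maximality forces to vanish.\<close>

lemma symmetric_matrix_invariant_subspace_eigenvector:
  fixes A :: "real^'n^'n"
  assumes sym: "transpose A = A" and V: "subspace V" "V \<noteq> {0}"
    and inv: "\<And>x. x \<in> V \<Longrightarrow> A *v x \<in> V"
  shows "\<exists>x\<in>V. \<exists>l. x \<noteq> 0 \<and> A *v x = l *\<^sub>R x"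
proof -
  let ?K = "sphere 0 1 \<inter> V"
  have "compact ?K" by (intro compact_Int_closed closed_subspace V) simp
  moreover have "?K \<noteq> {}"
  proof -
    obtain v where v: "v \<in> V" "v \<noteq> 0" using V subspace_0 by blast
    then have "(1 / norm v) *\<^sub>R v \<in> ?K" using V by (simp add: subspace_scale)
    then show ?thesis by blast
  qed
  moreover have "continuous_on ?K (\<lambda>x. x \<bullet> (A *v x))"
    by (intro continuous_intros)
  ultimately obtain x where x: "x \<in> ?K"
    and max: "\<forall>z\<in>?K. z \<bullet> (A *v z) \<le> x \<bullet> (A *v x)"
    using continuous_attains_sup[of ?K "\<lambda>x. x \<bullet> (A *v x)"] by blast
  then have x: "x \<in> V" "norm x = 1" by auto
  define \<mu> where "\<mu> = x \<bullet> (A *v x)"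
  have le: "z \<bullet> (A *v z) \<le> \<mu> * (z \<bullet> z)" if z: "z \<in> V" for z
  proof (cases "z = 0")
    case False
    define w where "w = (1 / norm z) *\<^sub>R z"
    have "w \<bullet> (A *v w) \<le> \<mu>"
      unfolding \<mu>_def by (rule max[rule_format]) (use z V False in \<open>auto simp: w_def subspace_scale\<close>)
    then have "(1 / norm z) * (1 / norm z) * (z \<bullet> (A *v z)) \<le> \<mu>"
      by (simp add: w_def matrix_vector_mult_scaleR)
    then show ?thesis using False
      by (simp add: divide_simps dot_square_norm power2_eq_square)
  qed simp
  define y where "y = A *v x - \<mu> *\<^sub>R x"
  define c where "c = y \<bullet> (A *v y) - \<mu> * (y \<bullet> y)"
  have yV: "y \<in> V" using x V inv by (auto simp: y_def intro: subspace_diff subspace_scale)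
  have var: "2 * t * (y \<bullet> y) + t\<^sup>2 * c \<le> 0" for t
  proof -
    have "x + t *\<^sub>R y \<in> V" using x yV V by (auto intro: subspace_add subspace_scale)
    from le[OF this] have "x \<bullet> (A *v x) + t * (x \<bullet> (A *v y)) + t * (y \<bullet> (A *v x)) + t\<^sup>2 * (y \<bullet> (A *v y))
      \<le> \<mu> * (x \<bullet> x + 2 * t * (y \<bullet> x) + t\<^sup>2 * (y \<bullet> y))"
      by (simp add: algebra_simps inner_commute power2_eq_square matrix_vector_mult_scaleR)
    moreover have "x \<bullet> (A *v y) = y \<bullet> (A *v x)"
      using symmetric_matrix_self_adjoint[OF sym, of x y] by (simp add: inner_commute)
    moreover have "x \<bullet> x = 1" using x by (simp add: dot_square_norm)
    moreover have "y \<bullet> (A *v x) = y \<bullet> y + \<mu> * (y \<bullet> x)"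
      by (subst (2) y_def) (simp add: inner_diff_right)
    ultimately show ?thesis unfolding c_def by (simp add: \<mu>_def[symmetric] algebra_simps)
  qed
  have "y \<bullet> y = 0"
  proof (rule ccontr)
    assume "y \<bullet> y \<noteq> 0"
    then have p: "0 < y \<bullet> y" by simp
    \<comment> \<open>So small that the quadratic term cannot outweigh the linear one.\<close>
    define t where "t = (y \<bullet> y) / (\<bar>c\<bar> + 1)"
    have t: "0 < t" "t * (\<bar>c\<bar> + 1) = y \<bullet> y" using p by (auto simp: t_def)
    have "t * (2 * (y \<bullet> y) + t * c) \<le> 0" using var[of t] by (simp add: algebra_simps power2_eq_square)
    then have "2 * (y \<bullet> y) + t * c \<le> 0" using t by (simp add: mult_le_0_iff)
    moreover have "- (t * \<bar>c\<bar>) \<le> t * c" using t(1) by (metis abs_ge_minus_self abs_mult abs_of_pos minus_le_iff)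
    moreover have "t * \<bar>c\<bar> \<le> y \<bullet> y" using t by (simp add: algebra_simps)
    ultimately show False using p by linarith
  qed
  then have "A *v x = \<mu> *\<^sub>R x" by (simp add: y_def)
  moreover have "x \<noteq> 0" using x by auto
  ultimately show ?thesis using x by blast
qed

lemma subspace_eigenspace: "subspace (eigenspace A l)"
  by (auto simp: subspace_def eigenspace_def algebra_simps matrix_vector_mult_scaleR)

lemma eigenspaces_orthogonal:
  assumes sym: "transpose A = A" and "x \<in> eigenspace A l" "y \<in> eigenspace A m" "l \<noteq> m"
  shows "x \<bullet> y = 0"
proof -
  have "x \<bullet> (A *v y) = (A *v x) \<bullet> y" by (rule symmetric_matrix_self_adjoint[OF sym])
  then have "m * (x \<bullet> y) = l * (x \<bullet> y)" using assms by (simp add: eigenspace_def)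
  then show ?thesis using \<open>l \<noteq> m\<close> by simp
qed

text \<open>Eigenvectors for distinct eigenvalues are orthogonal, hence linearly independent, so there
  are at most as many eigenvalues as dimensions.\<close>

lemma finite_spectrum:
  fixes A :: "real^'n^'n"
  assumes sym: "transpose A = A"
  shows "finite (spectrum A)"
proof -
  have "\<forall>l\<in>spectrum A. \<exists>x. x \<noteq> 0 \<and> A *v x = l *\<^sub>R x" by (simp add: spectrum_def)
  then obtain e where e: "\<And>l. l \<in> spectrum A \<Longrightarrow> e l \<noteq> 0 \<and> A *v e l = l *\<^sub>R e l"
    by metis
  have ort: "e l \<bullet> e m = 0" if "l \<in> spectrum A" "m \<in> spectrum A" "l \<noteq> m" for l m
    using eigenspaces_orthogonal[OF sym, of "e l" l "e m" m] e that by (auto simp: eigenspace_def)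
  then have inj: "inj_on e (spectrum A)"
    using e by (metis inj_onI inner_eq_zero_iff)
  have "independent (e ` spectrum A)"
    using ort e by (intro pairwise_orthogonal_independent) (auto simp: pairwise_def orthogonal_def)
  then have "finite (e ` spectrum A)" by (rule independent_imp_finite)
  then show ?thesis using inj by (rule finite_imageD)
qed

text \<open>For a subspace the variational inequality of the nearest point can be applied to
  \<open>z\<close> and to \<open>-z\<close>, which turns it into an orthogonality relation. This characterization is linear
  in \<open>x\<close> and \<open>p\<close>, and every later property of the eigenprojections is read off from it.\<close>

lemma closest_point_subspace_iff:
  fixes E :: "'a::euclidean_space set"
  assumes E: "subspace E"
  shows "closest_point E x = p \<longleftrightarrow> p \<in> E \<and> (\<forall>z\<in>E. (x - p) \<bullet> z = 0)"
proof -
  have prem: "convex E" "closed E" "E \<noteq> {}"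
    using E subspace_imp_convex closed_subspace subspace_0 by blast+
  define q where "q = closest_point E x"
  have q: "q \<in> E" using closest_point_in_set prem by (auto simp: q_def)
  have ort: "(x - q) \<bullet> z = 0" if z: "z \<in> E" for z
  proof -
    have "(x - q) \<bullet> (q + z - q) \<le> 0" "(x - q) \<bullet> (q - z - q) \<le> 0"
      unfolding q_def
      using closest_point_dot[OF prem(1,2), of "q + z" x] closest_point_dot[OF prem(1,2), of "q - z" x]
        q z E by (simp_all add: q_def subspace_add subspace_diff)
    then show ?thesis by simp
  qed
  have "p = q" if p: "p \<in> E" "\<forall>z\<in>E. (x - p) \<bullet> z = 0"
  proof -
    have "q - p \<in> E" using p q E by (simp add: subspace_diff)
    then have "(q - p) \<bullet> (q - p) = 0"
      using p ort[of "q - p"] by (simp add: inner_diff_left)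
    then show ?thesis by simp
  qed
  then show ?thesis using q ort by (auto simp: q_def[symmetric])
qed

lemma linear_closest_point_subspace:
  fixes E :: "'a::euclidean_space set"
  assumes E: "subspace E"
  shows "linear (closest_point E)"
proof -
  have cp: "closest_point E x \<in> E" "\<And>z. z \<in> E \<Longrightarrow> (x - closest_point E x) \<bullet> z = 0" for x
    using closest_point_subspace_iff[OF E] by blast+
  show ?thesis
  proof (rule linearI)
    show "closest_point E (x + y) = closest_point E x + closest_point E y" for x y
      unfolding closest_point_subspace_iff[OF E]
      using cp(1)[of x] cp(1)[of y] cp(2)[of _ x] cp(2)[of _ y] E
      by (auto simp: subspace_add inner_diff_left inner_add_left)
    show "closest_point E (c *\<^sub>R x) = c *\<^sub>R closest_point E x" for c x
      unfolding closest_point_subspace_iff[OF E]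
      using cp(1)[of x] cp(2)[of _ x] E
      by (auto simp: subspace_scale inner_diff_left)
  qed
qed

lemma eigenprojection_eq: "eigenprojection A l *v x = closest_point (eigenspace A l) x"
  unfolding eigenprojection_def
  by (rule matrix_works)
     (simp add: linear_matrix_vector_mul_eq linear_closest_point_subspace subspace_eigenspace)

lemma eigenprojection_in: "eigenprojection A l *v x \<in> eigenspace A l"
  and eigenprojection_orthogonal: "z \<in> eigenspace A l \<Longrightarrow> (x - eigenprojection A l *v x) \<bullet> z = 0"
  using closest_point_subspace_iff[OF subspace_eigenspace] unfolding eigenprojection_eq by blast+

lemma eigenprojection_eigenvector:
  assumes sym: "transpose A = A" and z: "z \<in> eigenspace A m"
  shows "eigenprojection A l *v z = (if l = m then z else 0)"
  unfolding eigenprojection_eq closest_point_subspace_iff[OF subspace_eigenspace]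
  using eigenspaces_orthogonal[OF sym z] z subspace_0[OF subspace_eigenspace] by auto

text \<open>The spectral theorem. The orthogonal complement \<open>V\<close> of all eigenspaces is invariant, so
  if it were nonzero it would contain an eigenvector orthogonal to itself. The defect of the
  resolution lies in \<open>V\<close>.\<close>

lemma sum_eigenprojections:
  fixes A :: "real^'n^'n"
  assumes sym: "transpose A = A"
  shows "(\<Sum>l\<in>spectrum A. eigenprojection A l *v x) = x"
proof -
  define V where "V = {z. \<forall>l\<in>spectrum A. \<forall>w\<in>eigenspace A l. z \<bullet> w = 0}"
  have V: "subspace V"
    by (auto simp: V_def subspace_def inner_add_left)
  have inv: "A *v z \<in> V" if "z \<in> V" for z
    using that symmetric_matrix_self_adjoint[OF sym, of z] by (simp add: V_def eigenspace_def) (metis inner_scaleR_right mult_zero_right)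
  have "V = {0}"
  proof (rule ccontr)
    assume "V \<noteq> {0}"
    then obtain z l where z: "z \<in> V" "z \<noteq> 0" "A *v z = l *\<^sub>R z"
      using symmetric_matrix_invariant_subspace_eigenvector[OF sym V _ inv] by blast
    then have "l \<in> spectrum A" "z \<in> eigenspace A l" by (auto simp: spectrum_def eigenspace_def)
    then have "z \<bullet> z = 0" using z(1) by (auto simp: V_def)
    then show False using z by simp
  qed
  moreover have "x - (\<Sum>l\<in>spectrum A. eigenprojection A l *v x) \<in> V"
    unfolding V_def
  proof (intro CollectI ballI)
    fix m w assume m: "m \<in> spectrum A" and w: "w \<in> eigenspace A m"
    have "(\<Sum>l\<in>spectrum A. (eigenprojection A l *v x) \<bullet> w)
        = (\<Sum>l\<in>spectrum A. if l = m then (eigenprojection A l *v x) \<bullet> w else 0)"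
      by (rule sum.cong) (use eigenspaces_orthogonal[OF sym eigenprojection_in w] in auto)
    also have "\<dots> = (eigenprojection A m *v x) \<bullet> w"
      using m finite_spectrum[OF sym] by simp
    finally show "(x - (\<Sum>l\<in>spectrum A. eigenprojection A l *v x)) \<bullet> w = 0"
      using eigenprojection_orthogonal[OF w, of x] by (simp add: inner_diff_left inner_sum_left)
  qed
  ultimately show ?thesis by simp
qed

section \<open>Functional calculus\<close>

lemma matrix_fun_mult:
  "matrix_fun \<omega> A *v x = (\<Sum>l\<in>spectrum A. \<omega> l *\<^sub>R (eigenprojection A l *v x))"
proof -
  have "sum f F *v x = (\<Sum>l\<in>F. f l *v x)" for f :: "real \<Rightarrow> real^'n^'n" and F and x :: "real^'n"
    by (induction F rule: infinite_finite_induct) (auto simp: matrix_vector_mult_add_rdistrib)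
  then show ?thesis by (simp add: matrix_fun_def scaleR_matrix_vector_assoc)
qed

lemma eigenprojection_matrix_fun:
  fixes A :: "real^'n^'n"
  assumes sym: "transpose A = A" and l: "l \<in> spectrum A"
  shows "eigenprojection A l *v (matrix_fun \<omega> A *v x) = \<omega> l *\<^sub>R (eigenprojection A l *v x)"
proof -
  have "eigenprojection A l *v (matrix_fun \<omega> A *v x)
    = (\<Sum>m\<in>spectrum A. \<omega> m *\<^sub>R (eigenprojection A l *v (eigenprojection A m *v x)))"
    by (simp add: matrix_fun_mult linear_sum[OF matrix_vector_mul_linear] matrix_vector_mult_scaleR)
  also have "\<dots> = (\<Sum>m\<in>spectrum A. if m = l then \<omega> m *\<^sub>R (eigenprojection A m *v x) else 0)"
    by (rule sum.cong) (auto simp: eigenprojection_eigenvector[OF sym eigenprojection_in])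
  finally show ?thesis using l finite_spectrum[OF sym] by simp
qed

lemma matrix_fun_eigenvector:
  fixes A :: "real^'n^'n"
  assumes sym: "transpose A = A" and l: "l \<in> spectrum A" and z: "z \<in> eigenspace A l"
  shows "matrix_fun \<omega> A *v z = \<omega> l *\<^sub>R z"
proof -
  have "matrix_fun \<omega> A *v z = (\<Sum>m\<in>spectrum A. if m = l then \<omega> m *\<^sub>R z else 0)"
    unfolding matrix_fun_mult
    by (rule sum.cong) (auto simp: eigenprojection_eigenvector[OF sym z])
  then show ?thesis using l finite_spectrum[OF sym] by simp
qed

lemma inner_eigenprojection:
  "x \<bullet> (eigenprojection A l *v x) = (norm (eigenprojection A l *v x))\<^sup>2"
  using eigenprojection_orthogonal[OF eigenprojection_in[of A l x], of x]
  by (simp add: inner_diff_left dot_square_norm)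

lemma inner_matrix_fun:
  "x \<bullet> (matrix_fun \<omega> A *v x) = (\<Sum>l\<in>spectrum A. \<omega> l * (norm (eigenprojection A l *v x))\<^sup>2)"
  by (simp add: matrix_fun_mult inner_sum_right inner_eigenprojection)

lemma matrix_fun_id:
  fixes A :: "real^'n^'n"
  assumes sym: "transpose A = A"
  shows "matrix_fun (\<lambda>l. l) A = A"
proof -
  have "matrix_fun (\<lambda>l. l) A *v x = A *v x" for x
  proof -
    have "A *v x = A *v (\<Sum>l\<in>spectrum A. eigenprojection A l *v x)"
      by (simp add: sum_eigenprojections[OF sym])
    also have "\<dots> = (\<Sum>l\<in>spectrum A. l *\<^sub>R (eigenprojection A l *v x))"
      unfolding linear_sum[OF matrix_vector_mul_linear]
      using eigenprojection_in[of A] by (simp add: eigenspace_def)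
    finally show ?thesis by (simp add: matrix_fun_mult)
  qed
  then show ?thesis by (simp add: matrix_eq)
qed

lemma matrix_fun_one:
  fixes A :: "real^'n^'n"
  assumes sym: "transpose A = A"
  shows "matrix_fun (\<lambda>l. 1) A = mat 1"
  by (simp add: matrix_eq matrix_fun_mult sum_eigenprojections[OF sym])

lemma matrix_fun_mult_right:
  fixes A :: "real^'n^'n"
  assumes sym: "transpose A = A"
  shows "matrix_fun \<omega> A ** A = matrix_fun (\<lambda>l. \<omega> l * l) A"
proof -
  have "eigenprojection A l *v (A *v x) = l *\<^sub>R (eigenprojection A l *v x)" if "l \<in> spectrum A" for l x
    using eigenprojection_matrix_fun[OF sym that, of "\<lambda>l. l" x] by (simp add: matrix_fun_id[OF sym])
  then have "matrix_fun \<omega> A *v (A *v x) = matrix_fun (\<lambda>l. \<omega> l * l) A *v x" for x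
    by (simp add: matrix_fun_mult)
  then show ?thesis by (simp add: matrix_eq matrix_vector_mul_assoc)
qed

lemma norm_eigenprojection_le: "norm (eigenprojection A l *v x) \<le> norm x"
proof -
  let ?p = "eigenprojection A l *v x"
  have "norm ?p * norm ?p = x \<bullet> ?p" by (simp add: inner_eigenprojection power2_eq_square)
  also have "\<dots> \<le> norm x * norm ?p" by (rule norm_cauchy_schwarz)
  finally show ?thesis by (cases "?p = 0") auto
qed

text \<open>An eigenvector for \<open>l\<close> shows that the norm of \<open>\<omega>(A)\<close> is at least \<open>\<omega> l\<close>, and one
  for \<open>m\<close> shows that the norm of the inverse is at least \<open>1 / \<omega> m\<close>.\<close>

lemma cond2_matrix_fun_ge:
  fixes A :: "real^'n^'n"
  assumes sym: "transpose A = A" and pos: "\<And>l. l \<in> spectrum A \<Longrightarrow> 0 < \<omega> l"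
    and l: "l \<in> spectrum A" and m: "m \<in> spectrum A"
  shows "\<omega> l / \<omega> m \<le> cond2 (matrix_fun \<omega> A)"
proof -
  define W where "W = matrix_fun \<omega> A"
  obtain x z where x: "x \<noteq> 0" "x \<in> eigenspace A l" and z: "z \<noteq> 0" "z \<in> eigenspace A m"
    using l m by (auto simp: spectrum_def eigenspace_def)
  have bnd: "norm (B *v w) \<le> spectral_norm B * norm w" for B :: "real^'n^'n" and w
    unfolding spectral_norm_def by (rule onorm) simp
  have "w = 0" if "W *v w = 0" for w
  proof -
    have "eigenprojection A k *v w = 0" if "k \<in> spectrum A" for k
      using eigenprojection_matrix_fun[OF sym that, of \<omega> w] \<open>W *v w = 0\<close> pos[OF that]
      by (simp add: W_def)
    then show ?thesis using sum_eigenprojections[OF sym, of w] by simp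
  qed
  then have "invertible W"
    using matrix_left_invertible_ker[of W] invertible_left_inverse by blast
  then have "matrix_inv W ** W = mat 1"
    unfolding matrix_inv_def invertible_def by (rule someI2_ex) simp
  then have "matrix_inv W *v (W *v z) = z" by (simp add: matrix_vector_mul_assoc)
  then have "norm z \<le> spectral_norm (matrix_inv W) * norm (W *v z)" by (metis bnd)
  also have "W *v z = \<omega> m *\<^sub>R z" unfolding W_def by (rule matrix_fun_eigenvector[OF sym m z(2)])
  finally have "1 \<le> spectral_norm (matrix_inv W) * \<omega> m"
    using z(1) pos[OF m] by (simp add: field_simps)
  then have i: "1 / \<omega> m \<le> spectral_norm (matrix_inv W)" using pos[OF m] by (simp add: field_simps)
  have "norm (W *v x) \<le> spectral_norm W * norm x" by (rule bnd)
  also have "W *v x = \<omega> l *\<^sub>R x" unfolding W_def by (rule matrix_fun_eigenvector[OF sym l x(2)])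
  finally have "\<omega> l \<le> spectral_norm W" using x(1) pos[OF l] by simp
  then have "\<omega> l * (1 / \<omega> m) \<le> spectral_norm W * spectral_norm (matrix_inv W)"
    using i pos[OF l] pos[OF m] by (intro mult_mono) auto
  then show ?thesis by (simp add: cond2_def W_def)
qed

section \<open>Orbits of the Barzilai-Borwein map\<close>

lemma spectrum_nonempty:
  fixes A :: "real^'n^'n"
  assumes sym: "transpose A = A"
  shows "spectrum A \<noteq> {}"
proof
  assume "spectrum A = {}"
  then have "(1 :: real^'n) = 0" using sum_eigenprojections[OF sym, of 1] by simp
  then show False by simp
qed

lemma sym_pos_def_spectrum_pos:
  assumes "sym_pos_def H" "l \<in> spectrum H"
  shows "0 < l"
proof -
  obtain x where x: "x \<noteq> 0" "H *v x = l *\<^sub>R x" using assms(2) by (auto simp: spectrum_def)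
  then have "0 < l * (x \<bullet> x)" using assms(1) by (auto simp: sym_pos_def_def)
  then show ?thesis by (metis inner_ge_zero not_less zero_less_mult_pos2 zero_less_mult_iff)
qed


text \<open>In eigencoordinates \<open>alpha_W\<close> is the reciprocal of a mean of the eigenvalues with positive
  weights, hence lies in the stated interval. The degenerate pair \<open>(0, 0)\<close> fits the same
  recursion with any step size in the interval.\<close>

lemma T_W_step:
  fixes H :: "real^'n^'n"
  assumes H: "sym_pos_def H" and pos: "\<And>l. l \<in> spectrum H \<Longrightarrow> 0 < \<omega> l"
    and uv: "(u, v) \<in> Omega_BB H" and W: "W = matrix_fun \<omega> H"
  shows "\<exists>\<alpha>\<in>{1 / lambda_max H .. 1 / lambda_min H}.
           T_W H W (u, v) = (v, (mat 1 - \<alpha> *\<^sub>R H) *v v) \<and>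
           \<alpha> * (u \<bullet> ((W ** H) *v u)) = u \<bullet> (W *v u)"
proof -
  have sym: "transpose H = H" using H by (simp add: sym_pos_def_def)
  note fin = finite_spectrum[OF sym] and ne = spectrum_nonempty[OF sym]
  have a: "0 < lambda_min H" unfolding lambda_min_def
    using sym_pos_def_spectrum_pos[OF H] Min_in[OF fin ne] by blast
  have ab: "lambda_min H \<le> l" "l \<le> lambda_max H" if "l \<in> spectrum H" for l
    using fin that by (auto simp: lambda_min_def lambda_max_def)
  show ?thesis
  proof (cases "u = 0")
    case True
    then have "v = 0" using uv by (auto simp: Omega_BB_def)
    moreover have "lambda_min H \<le> lambda_max H" using ab ne by force
    ultimately show ?thesis using True a
      by (intro bexI[of _ "1 / lambda_max H"]) (auto simp: T_W_def frac_le)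
  next
    case False
    define q where "q l = \<omega> l * (norm (eigenprojection H l *v u))\<^sup>2" for l
    have q0: "0 \<le> q l" if "l \<in> spectrum H" for l
      using pos[OF that] by (simp add: q_def)
    have num: "u \<bullet> (W *v u) = (\<Sum>l\<in>spectrum H. q l)"
      by (simp add: W inner_matrix_fun q_def)
    have den: "u \<bullet> ((W ** H) *v u) = (\<Sum>l\<in>spectrum H. l * q l)"
      by (simp add: W matrix_fun_mult_right[OF sym] inner_matrix_fun q_def ac_simps)
    have "\<exists>l\<in>spectrum H. eigenprojection H l *v u \<noteq> 0"
      using False sum_eigenprojections[OF sym, of u] by (metis sum.neutral)
    then obtain l where "l \<in> spectrum H" "eigenprojection H l *v u \<noteq> 0" by blast
    then have "0 < q l" using pos by (simp add: q_def)
    then have n0: "0 < u \<bullet> (W *v u)"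
      unfolding num by (intro sum_pos2[OF fin \<open>l \<in> spectrum H\<close>]) (use q0 in auto)
    have lo: "lambda_min H * (u \<bullet> (W *v u)) \<le> u \<bullet> ((W ** H) *v u)"
      unfolding num den sum_distrib_left by (intro sum_mono mult_right_mono ab q0)
    have hi: "u \<bullet> ((W ** H) *v u) \<le> lambda_max H * (u \<bullet> (W *v u))"
      unfolding num den sum_distrib_left by (intro sum_mono mult_right_mono ab q0)
    have d0: "0 < u \<bullet> ((W ** H) *v u)"
      using lo n0 a by (meson less_le_trans mult_pos_pos)
    have b: "0 < lambda_max H" using a ab ne by force
    have "alpha_W H W u \<in> {1 / lambda_max H .. 1 / lambda_min H}"
      using lo hi d0 a b by (simp add: alpha_W_def field_simps)
    moreover have "alpha_W H W u * (u \<bullet> ((W ** H) *v u)) = u \<bullet> (W *v u)"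
      using d0 by (simp add: alpha_W_def)
    ultimately show ?thesis using False by (intro bexI[of _ "alpha_W H W u"]) (auto simp: T_W_def)
  qed
qed

text \<open>Scaling each mode by \<open>sqrt (\<omega> l)\<close> absorbs the weight: both quadratic forms in
  \<open>alpha_W\<close> become sums over the scaled modes in which \<open>\<omega>\<close> no longer occurs. Membership of
  the starting pair in \<open>Omega_BB H\<close> supplies the initial step size.\<close>

lemma T_W_orbit_modes:
  fixes H :: "real^'n^'n"
  assumes H: "sym_pos_def H" and pos: "\<And>l. l \<in> spectrum H \<Longrightarrow> 0 < \<omega> l"
    and uv: "(u, v) \<in> Omega_BB H" and W: "W = matrix_fun \<omega> H"
  obtains g \<alpha> where "g 0 = u" "\<And>k. (T_W H W ^^ k) (u, v) = (g k, g (Suc k))"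
    "bb_modes (lambda_min H) (lambda_max H) (spectrum H) \<alpha>
       (\<lambda>l k. sqrt (\<omega> l) * norm (eigenprojection H l *v g k))"
proof -
  have sym: "transpose H = H" using H by (simp add: sym_pos_def_def)
  let ?I = "{1 / lambda_max H .. 1 / lambda_min H}"
  define z where "z k = (T_W H W ^^ k) (u, v)" for k
  define g where "g k = fst (z k)" for k
  have zS: "z (Suc k) = T_W H W (z k)" for k by (simp add: z_def)
  have zO: "z k \<in> Omega_BB H" for k
  proof (induction k)
    case 0
    then show ?case using uv by (simp add: z_def)
  next
    case (Suc k)
    obtain x y where xy: "z k = (x, y)" by fastforce
    then show ?case using T_W_step[where u = x and v = y, OF H pos _ W] Suc
      by (auto simp: zS Omega_BB_def)
  qed
  have "\<exists>t\<in>?I. z (Suc k) = (snd (z k), (mat 1 - t *\<^sub>R H) *v snd (z k)) \<and>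
      t * (g k \<bullet> ((W ** H) *v g k)) = g k \<bullet> (W *v g k)" for k
    using T_W_step[where u = "fst (z k)" and v = "snd (z k)", OF H pos _ W] zO[of k] by (simp add: zS g_def)
  then obtain t where t: "\<And>k. t k \<in> ?I"
    "\<And>k. z (Suc k) = (snd (z k), (mat 1 - t k *\<^sub>R H) *v snd (z k))"
    "\<And>k. t k * (g k \<bullet> ((W ** H) *v g k)) = g k \<bullet> (W *v g k)"
    by metis
  obtain \<beta> where \<beta>: "\<beta> \<in> ?I" "v = (mat 1 - \<beta> *\<^sub>R H) *v u"
    using uv by (auto simp: Omega_BB_def)
  define \<alpha> where "\<alpha> = case_nat \<beta> t"
  have snd: "snd (z k) = g (Suc k)" for k by (simp add: g_def t(2))
  have g0: "g 0 = u" by (simp add: g_def z_def)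
  have rec: "g (Suc k) = (mat 1 - \<alpha> k *\<^sub>R H) *v g k" for k
  proof (cases k)
    case 0
    have "g (Suc 0) = v" by (simp add: snd[symmetric] z_def)
    then show ?thesis using 0 \<beta> g0 by (simp add: \<alpha>_def)
  next
    case (Suc j)
    have "g (Suc (Suc j)) = snd (z (Suc j))" by (simp add: snd)
    also have "\<dots> = (mat 1 - t j *\<^sub>R H) *v g (Suc j)" by (simp only: t(2)[of j] snd) (simp add: snd)
    finally show ?thesis using Suc by (simp add: \<alpha>_def)
  qed
  have mode: "eigenprojection H l *v g (Suc k) = (1 - \<alpha> k * l) *\<^sub>R (eigenprojection H l *v g k)"
    if "l \<in> spectrum H" for l k
    using eigenprojection_matrix_fun[OF sym that, of "\<lambda>l. l" "g k"]
    by (simp add: rec matrix_fun_id[OF sym] matrix_vector_mult_diff_rdistrib matrix_vector_mult_diff_distrib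
        scaleR_matrix_vector_assoc[symmetric] matrix_vector_mult_scaleR algebra_simps)
  have sq: "(sqrt (\<omega> l) * norm x)\<^sup>2 = \<omega> l * (norm x)\<^sup>2" if "l \<in> spectrum H" for l and x :: "real^'n"
    using pos[OF that] by (simp add: power_mult_distrib)
  have "bb_modes (lambda_min H) (lambda_max H) (spectrum H) \<alpha>
       (\<lambda>l k. sqrt (\<omega> l) * norm (eigenprojection H l *v g k))"
    unfolding bb_modes_def
  proof (intro conjI allI ballI)
    show "\<alpha> k \<in> ?I" for k using \<beta> t by (cases k) (auto simp: \<alpha>_def)
    show "0 \<le> sqrt (\<omega> l) * norm (eigenprojection H l *v g k)" if "l \<in> spectrum H" for l k
      using pos[OF that] by simp
    show "sqrt (\<omega> l) * norm (eigenprojection H l *v g (Suc k))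
      = \<bar>1 - \<alpha> k * l\<bar> * (sqrt (\<omega> l) * norm (eigenprojection H l *v g k))"
      if "l \<in> spectrum H" for l k
      by (simp add: mode[OF that])
    show "\<alpha> (Suc k) * (\<Sum>l\<in>spectrum H. l * (sqrt (\<omega> l) * norm (eigenprojection H l *v g k))\<^sup>2)
       = (\<Sum>l\<in>spectrum H. (sqrt (\<omega> l) * norm (eigenprojection H l *v g k))\<^sup>2)" for k
      using t(3)[of k]
      by (simp add: \<alpha>_def sq W matrix_fun_mult_right[OF sym] inner_matrix_fun ac_simps cong: sum.cong)
  qed
  moreover have "(T_W H W ^^ k) (u, v) = (g k, g (Suc k))" for k
    using snd[of k] by (simp add: g_def z_def[symmetric] prod_eq_iff)
  ultimately show thesis using that g0 by blast
qed

text \<open>The constant is \<open>2 * card (spectrum H)\<close> times that of the scalar estimate: the cardinality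
  comes from adding up the modes, the factor 2 from the two components of the pair. All modes start
  below \<open>sqrt (\<omega> m) * norm u\<close>, where \<open>m\<close> maximizes \<open>\<omega>\<close>, and undoing the scaling of the
  mode \<open>l\<close> produces \<open>sqrt (\<omega> m / \<omega> l)\<close>.\<close>

lemma T_W_linear_decay:
  fixes H :: "real^'n^'n"
  assumes H: "sym_pos_def H"
  shows "\<exists>C\<ge>1. \<forall>W. positive_spectral_weight H W \<longrightarrow> (\<forall>u v. (u, v) \<in> Omega_BB H \<longrightarrow>
           (\<forall>k. norm ((T_W H W ^^ k) (u, v))
              \<le> C * sqrt (cond2 W) * bb_rate (lambda_min H) (lambda_max H) ^ k * norm (u, v)))"
proof -
  let ?S = "spectrum H"
  define r where "r = bb_rate (lambda_min H) (lambda_max H)"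
  have sym: "transpose H = H" using H by (simp add: sym_pos_def_def)
  note fin = finite_spectrum[OF sym] and ne = spectrum_nonempty[OF sym]
  have a: "0 < lambda_min H" unfolding lambda_min_def
    using sym_pos_def_spectrum_pos[OF H] Min_in[OF fin ne] by blast
  have sub: "?S \<subseteq> {lambda_min H .. lambda_max H}"
    using fin by (auto simp: lambda_min_def lambda_max_def)
  then have ab: "lambda_min H \<le> lambda_max H" using ne by fastforce
  have r: "0 < r" "r < 1" using bb_rate_bounds[OF a ab] by (auto simp: r_def)
  obtain C where C: "1 \<le> C" and dec: "\<And>\<alpha> y N l k. bb_modes (lambda_min H) (lambda_max H) ?S \<alpha> y \<Longrightarrow>
      (\<forall>l\<in>?S. y l 0 \<le> N) \<Longrightarrow> l \<in> ?S \<Longrightarrow> y l k \<le> C * r ^ k * N"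
    using bb_modes_decay[OF fin a ab sub] unfolding r_def by metis
  have "norm ((T_W H W ^^ k) (u, v)) \<le> (2 * real (card ?S) * C) * sqrt (cond2 W) * r ^ k * norm (u, v)"
    if PW: "positive_spectral_weight H W" and uv: "(u, v) \<in> Omega_BB H" for W u v k
  proof -
    obtain \<omega> where pos: "\<And>l. l \<in> ?S \<Longrightarrow> 0 < \<omega> l" and W: "W = matrix_fun \<omega> H"
      using PW by (auto simp: positive_spectral_weight_def)
    obtain g \<alpha> where g: "g 0 = u" "\<And>k. (T_W H W ^^ k) (u, v) = (g k, g (Suc k))"
      and modes: "bb_modes (lambda_min H) (lambda_max H) ?S \<alpha>
           (\<lambda>l k. sqrt (\<omega> l) * norm (eigenprojection H l *v g k))"
      by (rule T_W_orbit_modes[OF H pos uv W]) (assumption | rule that)+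
    have "Max (\<omega> ` ?S) \<in> \<omega> ` ?S" using fin ne by (intro Max_in) auto
    then obtain m where "m \<in> ?S" "Max (\<omega> ` ?S) = \<omega> m" by (rule imageE)
    then have m: "m \<in> ?S" "\<And>l. l \<in> ?S \<Longrightarrow> \<omega> l \<le> \<omega> m"
      using fin Max_ge[of "\<omega> ` ?S"] by auto
    have start: "\<forall>l\<in>?S. sqrt (\<omega> l) * norm (eigenprojection H l *v g 0) \<le> sqrt (\<omega> m) * norm u"
      using m pos[OF m(1)] norm_eigenprojection_le[of H _ u] by (auto simp: g intro!: mult_mono)
    have comp: "norm (eigenprojection H l *v g k) \<le> C * sqrt (cond2 W) * r ^ k * norm u"
      if l: "l \<in> ?S" for l k
    proof -
      have "sqrt (\<omega> l) * norm (eigenprojection H l *v g k) \<le> C * r ^ k * (sqrt (\<omega> m) * norm u)"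
        using dec[OF modes start l] .
      then have "norm (eigenprojection H l *v g k) \<le> C * r ^ k * norm u * sqrt (\<omega> m / \<omega> l)"
        using pos[OF l] by (simp add: real_sqrt_divide field_simps)
      also have "\<dots> \<le> C * r ^ k * norm u * sqrt (cond2 W)"
        using cond2_matrix_fun_ge[where \<omega> = \<omega>, OF sym pos m(1) l] C r W by (intro mult_left_mono) auto
      finally show ?thesis by (simp add: ac_simps)
    qed
    define B where "B = card ?S * C * sqrt (cond2 W) * norm u"
    have gk: "norm (g k) \<le> B * r ^ k" for k
    proof -
      have "norm (g k) = norm (\<Sum>l\<in>?S. eigenprojection H l *v g k)"
        by (simp add: sum_eigenprojections[OF sym])
      also have "\<dots> \<le> card ?S * (C * sqrt (cond2 W) * r ^ k * norm u)"
        by (intro sum_norm_bound comp)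
      finally show ?thesis by (simp add: B_def ac_simps)
    qed
    have B0: "0 \<le> B" using order_trans[OF norm_ge_zero gk[of 0]] by simp
    have "norm (g k, g (Suc k)) \<le> norm (g k) + norm (g (Suc k))" by (rule norm_Pair_le)
    also have "\<dots> \<le> B * r ^ k + B * r ^ Suc k" by (intro add_mono gk)
    also have "\<dots> \<le> B * r ^ k + B * r ^ k"
      using B0 r by (intro add_left_mono mult_left_mono power_decreasing) auto
    also have "\<dots> = 2 * card ?S * C * sqrt (cond2 W) * r ^ k * norm u" by (simp add: B_def)
    also have "\<dots> \<le> 2 * card ?S * C * sqrt (cond2 W) * r ^ k * norm (u, v)"
    proof -
      have "0 \<le> cond2 W" using cond2_matrix_fun_ge[where \<omega> = \<omega>, OF sym pos m(1) m(1)] pos[OF m(1)] W by simp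
      then show ?thesis using C r norm_fst_le[of u v] by (intro mult_left_mono) auto
    qed
    finally show ?thesis by (simp add: g)
  qed
  moreover have "1 \<le> 2 * real (card ?S) * C"
  proof -
    have "1 \<le> real (card ?S)" using fin ne by (simp add: Suc_leI card_gt_0_iff)
    then have "1 * 1 \<le> (2 * real (card ?S)) * C" using C by (intro mult_mono) auto
    then show ?thesis by simp
  qed
  ultimately show ?thesis
    unfolding r_def by (intro exI[of _ "2 * real (card ?S) * C"]) simp
qed

theorem theorem3p4:
  fixes H :: "real^'n^'n"
  assumes "sym_pos_def H"
  shows "(\<exists>C \<rho>. C \<ge> 1 \<and> 0 < \<rho> \<and> \<rho> < 1 \<and>
            (\<forall>W. positive_spectral_weight H W \<longrightarrow>
              (\<forall>u v. (u, v) \<in> Omega_BB H \<longrightarrow>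
                (\<forall>k::nat. norm ((T_W H W ^^ k) (u, v))
                   \<le> C * sqrt (cond2 W) * \<rho> ^ k * norm (u, v)))))
         \<and> positive_spectral_weight H (mat 1)
         \<and> positive_spectral_weight H H
         \<and> (\<forall>\<tau>::real. positive_spectral_weight H (matrix_powr H \<tau>))"
proof (intro conjI allI)
  have sym: "transpose H = H" using assms by (simp add: sym_pos_def_def)
  note pos = sym_pos_def_spectrum_pos[OF assms]
  note fin = finite_spectrum[OF sym] and ne = spectrum_nonempty[OF sym]
  have "0 < lambda_min H" "lambda_min H \<le> lambda_max H"
    using pos Min_in[OF fin ne] fin ne by (auto simp: lambda_min_def lambda_max_def)
  from bb_rate_bounds[OF this] T_W_linear_decay[OF assms]
  show "\<exists>C \<rho>. C \<ge> 1 \<and> 0 < \<rho> \<and> \<rho> < 1 \<and>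
            (\<forall>W. positive_spectral_weight H W \<longrightarrow>
              (\<forall>u v. (u, v) \<in> Omega_BB H \<longrightarrow>
                (\<forall>k::nat. norm ((T_W H W ^^ k) (u, v))
                   \<le> C * sqrt (cond2 W) * \<rho> ^ k * norm (u, v))))"
    by blast
  show "positive_spectral_weight H (mat 1)"
    unfolding positive_spectral_weight_def
    by (intro exI[of _ "\<lambda>l. 1"]) (simp add: matrix_fun_one[OF sym])
  show "positive_spectral_weight H H"
    unfolding positive_spectral_weight_def
    by (intro exI[of _ "\<lambda>l. l"]) (simp add: matrix_fun_id[OF sym] pos)
  show "positive_spectral_weight H (matrix_powr H \<tau>)" for \<tau>
    unfolding positive_spectral_weight_def matrix_powr_def
    by (intro exI[of _ "\<lambda>l. l powr \<tau>"]) (use pos in force)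
qed

end
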